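(* Let $\mathcal{A}=\{1,A_2,\ldots,A_n\}\subset\mathbb{R}_{\mathcal{F}}^{\wedge}$ be a strongly linearly independent (SLI) set of fuzzy numbers, with $A_i \in \mathbb{R}_{\mathcal{F}}\setminus\mathbb{R}$ for $i=2,\ldots,n$, and let $A,B\in\mathcal{S}(\mathcal{A})$. Consider the function $F_{A,B}:\mathcal{S}(\mathcal{A})\to\mathcal{S}(\mathcal{A})$ given by $$F_{A,B}(X)=A\odot_\psi X+_\psi B,\qquad X\in\mathcal{S}(\mathcal{A}).$$ If $[A]_1\neq\{0\}$, then $F_{A,B}$ is a bijection.
   Context: A fuzzy set on $\mathbb{R}$ is a function $A:\mathbb{R}\to[0,1]$. Its $\alpha$-levels are $[A]_\alpha=\{x\in\mathbb{R}: A(x)\ge\alpha\}$ for $\alpha\in(0,1]$, and $[A]_0$ is the closure of $\{x\in\mathbb{R}: A(x)>0\}$. A fuzzy number is a fuzzy set on $\mathbb{R}$ that is normal ($[A]_1\neq\emptyset$), fuzzy convex (all $\alpha$-levels are convex), upper semicontinuous, and has bounded support; equivalently, all its $\alpha$-levels, $\alpha\in[0,1]$, are non-empty compact intervals. $\mathbb{R}_{\mathcal{F}}$ denotes the set of fuzzy numbers, and $\mathbb{R}_{\mathcal{F}}^{\wedge}=\{A\in\mathbb{R}_{\mathcal{F}}: [A]_1 \text{ has exactly one element}\}$. A real number $r$ is identified with the fuzzy number given by the indicator function of $\{r\}$; in this sense $1\in\mathcal{A}$ and $\mathbb{R}\subset\mathbb{R}_{\mathcal{F}}^{\wedge}$.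 The usual sum and scalar multiplication on $\mathbb{R}_{\mathcal{F}}$ are levelwise: $[A+B]_\alpha=[A]_\alpha+[B]_\alpha$ (Minkowski sum of intervals) and $[qA]_\alpha=\{qx: x\in[A]_\alpha\}$ for $q\in\mathbb{R}$, for all $\alpha\in[0,1]$. For a finite set $\mathcal{A}=\{A_1,\ldots,A_n\}\subset\mathbb{R}_{\mathcal{F}}$, $\mathcal{S}(\mathcal{A})=\{q_1A_1+\cdots+q_nA_n: q_1,\ldots,q_n\in\mathbb{R}\}$, with the usual operations. A fuzzy number $B$ is symmetric with respect to $0$ if $B(-y)=B(y)$ for all $y\in\mathbb{R}$. The set $\mathcal{A}$ is strongly linearly independent (SLI) if, for all $q_1,\ldots,q_n\in\mathbb{R}$, whenever $q_1A_1+\cdots+q_nA_n$ is symmetric with respect to $0$, one has $q_1=\cdots=q_n=0$. It is known that if $\mathcal{A}$ is SLI, then $\psi:\mathbb{R}^n\to\mathcal{S}(\mathcal{A})$, $\psi(x_1,\ldots,x_n)=x_1A_1+\cdots+x_nA_n$, is a bijection. Here $A_1=1$. The $\psi$-operations on $\mathcal{S}(\mathcal{A})$ are those transported from $\mathbb{R}^n$ by $\psi$: for $B=\psi(q_1,\ldots,q_n)$, $C=\psi(p_1,\ldots,p_n)$ and $\lambda\in\mathbb{R}$, $B+_\psi C=\psi(q_1+p_1,\ldots,q_n+p_n)$, $B-_\psi C=\psi(q_1-p_1,\ldots,q_n-p_n)$, and $\lambda B=\lambda\cdot_\psi B=\psi(\lambda q_1,\ldots,\lambda q_n)$. Since $\mathcal{A}\subset\mathbb{R}_{\mathcal{F}}^{\wedge}$,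 every element of $\mathcal{S}(\mathcal{A})$ lies in $\mathbb{R}_{\mathcal{F}}^{\wedge}$. The $\psi$-cross product of $B,C\in\mathcal{S}(\mathcal{A})$ with $[B]_1=\{b\}$ and $[C]_1=\{c\}$ is $B\odot_\psi C=cB+_\psi bC-_\psi bc$, where the real number $bc$ is regarded as $\psi(bc,0,\ldots,0)\in\mathcal{S}(\mathcal{A})$. *)

theory Defs
  imports "HOL-Analysis.Analysis"
begin

section \<open>Fuzzy numbers\<close>

definition fuzzy_level :: "(real \<Rightarrow> real) \<Rightarrow> real \<Rightarrow> real set" where
  "fuzzy_level A \<alpha> = (if \<alpha> = 0 then closure {x. A x > 0} else {x. A x \<ge> \<alpha>})"

definition upper_semicontinuous :: "(real \<Rightarrow> real) \<Rightarrow> bool" where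
  "upper_semicontinuous A \<longleftrightarrow> (\<forall>x c. A x < c \<longrightarrow> (\<forall>\<^sub>F y in nhds x. A y < c))"

definition is_fuzzy_number :: "(real \<Rightarrow> real) \<Rightarrow> bool" where
  "is_fuzzy_number A \<longleftrightarrow>
     (\<forall>x. 0 \<le> A x \<and> A x \<le> 1) \<and>
     fuzzy_level A 1 \<noteq> {} \<and>
     (\<forall>\<alpha>\<in>{0..1}. convex (fuzzy_level A \<alpha>)) \<and>
     upper_semicontinuous A \<and>
     bounded {x. A x > 0}"

text \<open>
  The families of sets that arise as level families of fuzzy numbers. They are only used to show
  that levelwise operations are well defined.
\<close>

definition level_family :: "(real \<Rightarrow> 'a::euclidean_space set) \<Rightarrow> bool" where
  "level_family K \<longleftrightarrow>
     (\<forall>\<alpha>\<in>{0..1}. compact (K \<alpha>) \<and> convex (K \<alpha>) \<and> K \<alpha> \<noteq> {}) \<and>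
     (\<forall>\<alpha>\<in>{0..1}. \<forall>\<beta>\<in>{0..1}. \<alpha> \<le> \<beta> \<longrightarrow> K \<beta> \<subseteq> K \<alpha>) \<and>
     (\<forall>\<alpha>\<in>{0<..1}. \<forall>x. (\<forall>\<beta>\<in>{0<..<\<alpha>}. x \<in> K \<beta>) \<longrightarrow> x \<in> K \<alpha>) \<and>
     K 0 \<subseteq> closure (\<Union>\<beta>\<in>{0<..1}. K \<beta>)"

lemma level_familyD:
  assumes "level_family K"
  shows "\<And>\<alpha>. \<alpha> \<in> {0..1} \<Longrightarrow> compact (K \<alpha>)"
    and "\<And>\<alpha>. \<alpha> \<in> {0..1} \<Longrightarrow> convex (K \<alpha>)"
    and "\<And>\<alpha>. \<alpha> \<in> {0..1} \<Longrightarrow> K \<alpha> \<noteq> {}"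
    and "\<And>\<alpha> \<beta>. 0 \<le> \<alpha> \<Longrightarrow> \<alpha> \<le> \<beta> \<Longrightarrow> \<beta> \<le> 1 \<Longrightarrow> K \<beta> \<subseteq> K \<alpha>"
    and "\<And>\<alpha> x. 0 < \<alpha> \<Longrightarrow> \<alpha> \<le> 1 \<Longrightarrow> (\<And>\<beta>. 0 < \<beta> \<Longrightarrow> \<beta> < \<alpha> \<Longrightarrow> x \<in> K \<beta>) \<Longrightarrow> x \<in> K \<alpha>"
    and "K 0 \<subseteq> closure (\<Union>\<beta>\<in>{0<..1}. K \<beta>)"
proof -
  show "\<And>\<alpha> \<beta>. 0 \<le> \<alpha> \<Longrightarrow> \<alpha> \<le> \<beta> \<Longrightarrow> \<beta> \<le> 1 \<Longrightarrow> K \<beta> \<subseteq> K \<alpha>"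
    using assms unfolding level_family_def by (meson atLeastAtMost_iff order_trans)
qed (use assms in \<open>auto simp: level_family_def\<close>)

lemma level_family_fuzzy_level:
  assumes "is_fuzzy_number A"
  shows "level_family (fuzzy_level A)"
proof -
  have rng: "\<And>x. 0 \<le> A x" "\<And>x. A x \<le> 1" and ne: "fuzzy_level A 1 \<noteq> {}"
    and cvx: "\<And>\<alpha>. \<alpha> \<in> {0..1} \<Longrightarrow> convex (fuzzy_level A \<alpha>)"
    and usc: "upper_semicontinuous A" and bdd: "bounded {x. A x > 0}"
    using assms by (auto simp: is_fuzzy_number_def)
  have sub0: "{x. A x \<ge> \<alpha>} \<subseteq> {x. A x > 0}" if "0 < \<alpha>" for \<alpha>
    using that by auto
  have cl: "closed {x. A x \<ge> c}" for c
  proof -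
    have "open {x. A x < c}"
      using usc unfolding upper_semicontinuous_def eventually_nhds
      by (subst open_subopen) fastforce
    then show ?thesis
      by (simp add: closed_def Compl_eq not_le)
  qed
  have mono: "fuzzy_level A \<beta> \<subseteq> fuzzy_level A \<alpha>" if "0 \<le> \<alpha>" "\<alpha> \<le> \<beta>" for \<alpha> \<beta>
    using that closure_subset[of "{x. A x > 0}"] by (auto simp: fuzzy_level_def)
  have cpt: "compact (fuzzy_level A \<alpha>)" if "\<alpha> \<in> {0..1}" for \<alpha>
  proof (cases "\<alpha> = 0")
    case True
    then show ?thesis using bdd by (simp add: fuzzy_level_def compact_closure)
  next
    case False
    then show ?thesis
      using cl[of \<alpha>] bounded_subset[OF bdd sub0[of \<alpha>]] that
      by (auto simp: fuzzy_level_def compact_eq_bounded_closed)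
  qed
  have ne': "fuzzy_level A \<alpha> \<noteq> {}" if "\<alpha> \<in> {0..1}" for \<alpha>
    using mono[of \<alpha> 1] ne that by auto
  have int: "x \<in> fuzzy_level A \<alpha>"
    if "\<alpha> \<in> {0<..1}" "\<forall>\<beta>\<in>{0<..<\<alpha>}. x \<in> fuzzy_level A \<beta>" for \<alpha> x
  proof -
    have "\<beta> \<le> A x" if "0 < \<beta>" "\<beta> < \<alpha>" for \<beta>
      using \<open>\<forall>\<beta>\<in>{0<..<\<alpha>}. _\<close> that by (auto simp: fuzzy_level_def)
    then have "\<alpha> \<le> A x"
      using dense_le_bounded[of 0 \<alpha> "A x"] that(1) by auto
    then show ?thesis
      using that(1) by (auto simp: fuzzy_level_def)
  qed
  have "{x. A x > 0} \<subseteq> (\<Union>\<beta>\<in>{0<..1}. fuzzy_level A \<beta>)"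
    using rng by (force simp: fuzzy_level_def)
  then have "fuzzy_level A 0 \<subseteq> closure (\<Union>\<beta>\<in>{0<..1}. fuzzy_level A \<beta>)"
    unfolding fuzzy_level_def[of A 0] by (simp add: closure_mono)
  with cpt cvx ne' mono int show ?thesis
    unfolding level_family_def by auto
qed

lemma level_family_bounded_linear_image:
  fixes f :: "'a::euclidean_space \<Rightarrow> 'b::euclidean_space"
  assumes K: "level_family K" and f: "bounded_linear f"
  shows "level_family (\<lambda>\<alpha>. f ` K \<alpha>)"
proof -
  note KD = level_familyD[OF K]
  have contf: "continuous_on S f" for S
    using f by (simp add: linear_continuous_on)
  have linf: "linear f" using f by (simp add: bounded_linear.linear)
  have int: "y \<in> f ` K \<alpha>"
    if "\<alpha> \<in> {0<..1}" and y: "\<forall>\<beta>\<in>{0<..<\<alpha>}. y \<in> f ` K \<beta>" for \<alpha> y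
  proof -
    let ?F = "\<lambda>\<beta>. K \<beta> \<inter> f -` {y}"
    have clv: "closed (f -` {y})"
      using contf by (metis closed_singleton continuous_on_closed_vimage closed_UNIV Int_UNIV_right)
    have "compact (?F (\<alpha>/2)) \<and> ((\<Inter>\<beta>\<in>{0<..<\<alpha>}. ?F \<beta>) \<noteq> {})"
    proof
      show c2: "compact (?F (\<alpha>/2))"
        using that clv by (intro compact_Int_closed KD(1)) auto
      have "?F (\<alpha>/2) \<inter> (\<Inter>\<beta>\<in>{0<..<\<alpha>}. ?F \<beta>) \<noteq> {}"
      proof (rule compact_imp_fip_image[OF c2])
        show "closed (?F \<beta>)" if "\<beta> \<in> {0<..<\<alpha>}" for \<beta>
          using that \<open>\<alpha> \<in> _\<close>
          by (intro compact_imp_closed compact_Int_closed[OF KD(1) clv]) auto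
        fix I' assume I': "finite I'" "I' \<subseteq> {0<..<\<alpha>}"
        define m where "m = Max (insert (\<alpha>/2) I')"
        have "m \<in> insert (\<alpha>/2) I'" unfolding m_def using I' by (intro Max_in) auto
        then have m: "0 < m" "m < \<alpha>" using I' that by auto
        have le: "\<beta> \<le> m" if "\<beta> \<in> insert (\<alpha>/2) I'" for \<beta>
          unfolding m_def using I' that by (intro Max_ge) auto
        have "y \<in> f ` K m" using y m by simp
        then obtain x where x: "x \<in> K m" "f x = y" by auto
        have "x \<in> K \<beta>" if "\<beta> \<in> insert (\<alpha>/2) I'" for \<beta>
        proof -
          have "0 \<le> \<beta>" using that I' \<open>\<alpha> \<in> _\<close> by auto
          then show ?thesis
            using KD(4)[of \<beta> m] le[OF that] m \<open>\<alpha> \<in> _\<close> x by auto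
        qed
        then have "x \<in> ?F (\<alpha>/2) \<inter> (\<Inter>\<beta>\<in>I'. ?F \<beta>)"
          using x by auto
        then show "?F (\<alpha>/2) \<inter> (\<Inter>\<beta>\<in>I'. ?F \<beta>) \<noteq> {}"
          by blast
      qed
      then show "(\<Inter>\<beta>\<in>{0<..<\<alpha>}. ?F \<beta>) \<noteq> {}" by auto
    qed
    then obtain x where "x \<in> (\<Inter>\<beta>\<in>{0<..<\<alpha>}. ?F \<beta>)"
      by blast
    then have x: "\<And>\<beta>. \<beta> \<in> {0<..<\<alpha>} \<Longrightarrow> x \<in> K \<beta> \<and> f x = y"
      by blast
    have "x \<in> K \<alpha>"
      by (rule KD(5)) (use that(1) x in auto)
    moreover have "f x = y"
      using x[of "\<alpha>/2"] that(1) by auto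
    ultimately show ?thesis by auto
  qed
  have "f ` K 0 \<subseteq> f ` closure (\<Union>\<beta>\<in>{0<..1}. K \<beta>)"
    using KD(6) by (rule image_mono)
  also have "\<dots> \<subseteq> closure (f ` (\<Union>\<beta>\<in>{0<..1}. K \<beta>))"
    using f by (rule closure_bounded_linear_image_subset)
  finally have "f ` K 0 \<subseteq> closure (\<Union>\<beta>\<in>{0<..1}. f ` K \<beta>)"
    by (simp add: image_UN)
  moreover have "f ` K \<beta> \<subseteq> f ` K \<alpha>" if "0 \<le> \<alpha>" "\<alpha> \<le> \<beta>" "\<beta> \<le> 1" for \<alpha> \<beta>
    using KD(4)[OF that] by (rule image_mono)
  ultimately show ?thesis
    using int KD(1,2,3) contf linf unfolding level_family_def
    by (auto intro: compact_continuous_image convex_linear_image)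
qed

lemma level_family_Times:
  assumes K: "level_family K" and L: "level_family L"
  shows "level_family (\<lambda>\<alpha>. K \<alpha> \<times> L \<alpha>)"
proof -
  note KD = level_familyD[OF K] and LD = level_familyD[OF L]
  have "(\<Union>\<beta>\<in>{0<..1}. K \<beta>) \<times> (\<Union>\<beta>\<in>{0<..1}. L \<beta>) \<subseteq> (\<Union>\<beta>\<in>{0<..1}. K \<beta> \<times> L \<beta>)"
  proof clarify
    fix x y \<beta> \<gamma> assume *: "\<beta> \<in> {0<..1::real}" "x \<in> K \<beta>" "\<gamma> \<in> {0<..1::real}" "y \<in> L \<gamma>"
    then have "x \<in> K (min \<beta> \<gamma>)" "y \<in> L (min \<beta> \<gamma>)"
      using KD(4)[of "min \<beta> \<gamma>" \<beta>] LD(4)[of "min \<beta> \<gamma>" \<gamma>] by auto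
    moreover have "min \<beta> \<gamma> \<in> {0<..1}" using * by auto
    ultimately show "(x, y) \<in> (\<Union>\<beta>\<in>{0<..1}. K \<beta> \<times> L \<beta>)" by blast
  qed
  then have "K 0 \<times> L 0 \<subseteq> closure (\<Union>\<beta>\<in>{0<..1}. K \<beta> \<times> L \<beta>)"
    using Sigma_mono[OF KD(6) LD(6)] closure_mono unfolding closure_Times[symmetric]
    by (meson subset_trans)
  moreover have "K \<beta> \<times> L \<beta> \<subseteq> K \<alpha> \<times> L \<alpha>" if "0 \<le> \<alpha>" "\<alpha> \<le> \<beta>" "\<beta> \<le> 1" for \<alpha> \<beta>
    using KD(4)[OF that] LD(4)[OF that] by auto
  ultimately show ?thesis
    using KD(1,2,3,5) LD(1,2,3,5) unfolding level_family_def
    by (auto intro: compact_Times convex_Times)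
qed

lemma is_fuzzy_number_of_level_family:
  fixes L :: "real \<Rightarrow> real set"
  assumes L: "level_family L"
  shows "\<exists>A. is_fuzzy_number A \<and> (\<forall>\<alpha>\<in>{0..1}. fuzzy_level A \<alpha> = L \<alpha>)"
proof -
  note LD = level_familyD[OF L]
  define S where "S x = insert 0 {\<alpha>\<in>{0<..1}. x \<in> L \<alpha>}" for x
  define A where "A x = Sup (S x)" for x
  have bdd: "bdd_above (S x)" for x
    by (rule bdd_aboveI[of _ 1]) (auto simp: S_def)
  have ge0: "0 \<le> A x" for x
    unfolding A_def using bdd by (intro cSup_upper) (auto simp: S_def)
  have le1: "A x \<le> 1" for x
    unfolding A_def by (intro cSup_least) (auto simp: S_def)
  have iff: "\<alpha> \<le> A x \<longleftrightarrow> x \<in> L \<alpha>" if "0 < \<alpha>" "\<alpha> \<le> 1" for \<alpha> x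
  proof
    assume "x \<in> L \<alpha>"
    then show "\<alpha> \<le> A x"
      unfolding A_def using bdd that by (intro cSup_upper) (auto simp: S_def)
  next
    assume le: "\<alpha> \<le> A x"
    show "x \<in> L \<alpha>"
    proof (rule LD(5)[OF that])
      fix \<beta> assume \<beta>: "0 < \<beta>" "\<beta> < \<alpha>"
      then have "\<beta> < Sup (S x)" using le by (simp add: A_def)
      then obtain \<gamma> where "\<gamma> \<in> S x" "\<beta> < \<gamma>"
        using less_cSupE[of \<beta> "S x"] by (auto simp: S_def)
      then have "\<gamma> \<le> 1" "x \<in> L \<gamma>" using \<beta> by (auto simp: S_def)
      then show "x \<in> L \<beta>"
        using LD(4)[of \<beta> \<gamma>] \<beta> \<open>\<beta> < \<gamma>\<close> by auto
    qed
  qed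
  have pos: "{x. A x > 0} = (\<Union>\<beta>\<in>{0<..1}. L \<beta>)"
  proof (intro equalityI subsetI)
    fix x assume "x \<in> {x. A x > 0}"
    then show "x \<in> (\<Union>\<beta>\<in>{0<..1}. L \<beta>)"
      using iff[of "A x" x] le1[of x] by auto
  next
    fix x assume "x \<in> (\<Union>\<beta>\<in>{0<..1}. L \<beta>)"
    then show "x \<in> {x. A x > 0}" using iff[of _ x] by force
  qed
  have sub: "(\<Union>\<beta>\<in>{0<..1}. L \<beta>) \<subseteq> L 0"
    using LD(4) by (intro UN_least) auto
  have "closure (\<Union>\<beta>\<in>{0<..1}. L \<beta>) = L 0"
    using LD(6) closure_minimal[OF sub compact_imp_closed[OF LD(1)]] by auto
  then have lev: "fuzzy_level A \<alpha> = L \<alpha>" if "\<alpha> \<in> {0..1}" for \<alpha>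
    using that iff[of \<alpha>] pos by (auto simp: fuzzy_level_def)
  have usc: "upper_semicontinuous A"
    unfolding upper_semicontinuous_def
  proof (intro allI impI)
    fix x c assume c: "A x < c"
    show "\<forall>\<^sub>F y in nhds x. A y < c"
    proof (cases "c \<le> 1")
      case True
      have c0: "0 < c" using ge0[of x] c by simp
      have "open (- L c)" using LD(1)[of c] True c0 by (simp add: compact_imp_closed open_Compl)
      moreover have "x \<in> - L c" using iff[of c x] c True c0 by auto
      ultimately have "\<forall>\<^sub>F y in nhds x. y \<in> - L c" by (rule eventually_nhds_in_open)
      then show ?thesis
        by eventually_elim (use iff[of c] True c0 in \<open>auto simp: not_le[symmetric]\<close>)
    next
      case False
      then show ?thesis by (intro always_eventually allI le_less_trans[OF le1]) simp
    qed
  qed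
  have "bounded {x. A x > 0}"
    unfolding pos using sub LD(1)[of 0] by (auto intro: bounded_subset compact_imp_bounded)
  with ge0 le1 usc lev LD(2,3) have "is_fuzzy_number A"
    by (auto simp: is_fuzzy_number_def)
  with lev show ?thesis by blast
qed

lemma is_fuzzy_number_eqI:
  assumes "is_fuzzy_number A" "is_fuzzy_number B"
    and lev: "\<And>\<alpha>. \<alpha> \<in> {0<..1} \<Longrightarrow> fuzzy_level A \<alpha> = fuzzy_level B \<alpha>"
  shows "A = B"
proof
  fix x
  have rng: "0 \<le> A x" "A x \<le> 1" "0 \<le> B x" "B x \<le> 1"
    using assms(1,2) by (auto simp: is_fuzzy_number_def)
  have "\<alpha> \<le> A x \<longleftrightarrow> \<alpha> \<le> B x" if "\<alpha> \<in> {0<..1}" for \<alpha>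
    using lev[OF that] that by (auto simp: fuzzy_level_def set_eq_iff)
  from this[of "A x"] this[of "B x"] rng show "A x = B x"
    by (cases "A x = 0"; cases "B x = 0") auto
qed

lemma is_fuzzy_number_indicator: "is_fuzzy_number (indicator {r})"
proof -
  have lev: "fuzzy_level (indicator {r}) \<alpha> = {r}" if "\<alpha> \<in> {0..1}" for \<alpha>
    using that by (auto simp: fuzzy_level_def indicator_def)
  have usc: "upper_semicontinuous (indicator {r})"
    unfolding upper_semicontinuous_def
  proof (intro allI impI)
    fix x c :: real assume c: "indicator {r} x < c"
    show "\<forall>\<^sub>F y in nhds x. indicator {r} y < c"
    proof (cases "x = r")
      case True
      then show ?thesis using c
        by (intro always_eventually) (auto simp: indicator_def)
    next
      case False
      then have "\<forall>\<^sub>F y in nhds x. y \<in> - {r}"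
        by (intro eventually_nhds_in_open) auto
      then show ?thesis by eventually_elim (use c False in \<open>auto simp: indicator_def\<close>)
    qed
  qed
  have "{x. indicator {r} x > (0::real)} = {r}" by (auto simp: indicator_def)
  with lev usc show ?thesis by (auto simp: is_fuzzy_number_def indicator_def)
qed

typedef fuzzy_number = "{A. is_fuzzy_number A}"
  morphisms membership Abs_fuzzy_number
  using is_fuzzy_number_indicator by blast

abbreviation level :: "fuzzy_number \<Rightarrow> real \<Rightarrow> real set" where
  "level A \<equiv> fuzzy_level (membership A)"

text \<open>The embedding of the reals into the fuzzy numbers.\<close>

definition crisp :: "real \<Rightarrow> fuzzy_number" where
  "crisp r = Abs_fuzzy_number (indicator {r})"

lemma level_crisp: "\<alpha> \<in> {0..1} \<Longrightarrow> level (crisp r) \<alpha> = {r}"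
  by (auto simp: crisp_def Abs_fuzzy_number_inverse is_fuzzy_number_indicator fuzzy_level_def
      indicator_def)

lemma level_family_level: "level_family (level A)"
  using membership[of A] by (intro level_family_fuzzy_level) simp

lemma fuzzy_number_eqI:
  assumes "\<And>\<alpha>. \<alpha> \<in> {0..1} \<Longrightarrow> level A \<alpha> = level B \<alpha>"
  shows "A = B"
  using assms membership[of A] membership[of B]
  by (intro membership_inject[THEN iffD1] is_fuzzy_number_eqI) auto

lemma ex1_level:
  assumes "level_family L"
  shows "\<exists>!C. \<forall>\<alpha>\<in>{0..1}. level C \<alpha> = L \<alpha>"
proof -
  obtain A where A: "is_fuzzy_number A" "\<forall>\<alpha>\<in>{0..1}. fuzzy_level A \<alpha> = L \<alpha>"
    using is_fuzzy_number_of_level_family[OF assms] by blast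
  show ?thesis
  proof (rule ex1I[of _ "Abs_fuzzy_number A"])
    show "\<forall>\<alpha>\<in>{0..1}. level (Abs_fuzzy_number A) \<alpha> = L \<alpha>"
      using A by (simp add: Abs_fuzzy_number_inverse)
    then show "\<And>C. \<forall>\<alpha>\<in>{0..1}. level C \<alpha> = L \<alpha> \<Longrightarrow> C = Abs_fuzzy_number A"
      by (intro fuzzy_number_eqI) simp
  qed
qed

instantiation fuzzy_number :: "{zero, plus, scaleR}"
begin

definition zero_fuzzy_number :: fuzzy_number where
  "0 = crisp 0"

definition plus_fuzzy_number :: "fuzzy_number \<Rightarrow> fuzzy_number \<Rightarrow> fuzzy_number" where
  "A + B = (THE C. \<forall>\<alpha>\<in>{0..1}. level C \<alpha> = {x + y |x y. x \<in> level A \<alpha> \<and> y \<in> level B \<alpha>})"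

definition scaleR_fuzzy_number :: "real \<Rightarrow> fuzzy_number \<Rightarrow> fuzzy_number" where
  "q *\<^sub>R A = (THE C. \<forall>\<alpha>\<in>{0..1}. level C \<alpha> = {q * x |x. x \<in> level A \<alpha>})"

instance ..

end

lemma level_plus:
  assumes "\<alpha> \<in> {0..1}"
  shows "level (A + B) \<alpha> = {x + y |x y. x \<in> level A \<alpha> \<and> y \<in> level B \<alpha>}"
proof -
  have "level_family (\<lambda>\<alpha>. (\<lambda>p. fst p + snd p) ` (level A \<alpha> \<times> level B \<alpha>))"
    by (intro level_family_bounded_linear_image level_family_Times level_family_level
        bounded_linear_add bounded_linear_fst bounded_linear_snd)
  moreover have "(\<lambda>p. fst p + snd p) ` (level A \<alpha> \<times> level B \<alpha>)
      = {x + y |x y. x \<in> level A \<alpha> \<and> y \<in> level B \<alpha>}" for \<alpha>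
    by force
  ultimately have "level_family (\<lambda>\<alpha>. {x + y |x y. x \<in> level A \<alpha> \<and> y \<in> level B \<alpha>})"
    by simp
  from theI'[OF ex1_level[OF this]] assms show ?thesis
    by (simp add: plus_fuzzy_number_def)
qed

lemma level_scaleR:
  assumes "\<alpha> \<in> {0..1}"
  shows "level (q *\<^sub>R A) \<alpha> = {q * x |x. x \<in> level A \<alpha>}"
proof -
  have "level_family (\<lambda>\<alpha>. (\<lambda>x. q * x) ` level A \<alpha>)"
    by (rule level_family_bounded_linear_image[OF level_family_level bounded_linear_mult_right])
  moreover have "(\<lambda>x. q * x) ` level A \<alpha> = {q * x |x. x \<in> level A \<alpha>}" for \<alpha>
    by auto
  ultimately have "level_family (\<lambda>\<alpha>. {q * x |x. x \<in> level A \<alpha>})"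
    by simp
  from theI'[OF ex1_level[OF this]] assms show ?thesis
    by (simp add: scaleR_fuzzy_number_def)
qed

text \<open>
  Scalar multiplication does not distribute over addition of scalars, so the fuzzy numbers are
  not a vector space.
\<close>

instance fuzzy_number :: comm_monoid_add
proof
  fix A B C :: fuzzy_number
  show "A + B + C = A + (B + C)"
  proof (rule fuzzy_number_eqI)
    fix \<alpha> :: real assume "\<alpha> \<in> {0..1}"
    show "level (A + B + C) \<alpha> = level (A + (B + C)) \<alpha>"
      unfolding level_plus[OF \<open>\<alpha> \<in> {0..1}\<close>]
      by (intro set_eqI iffI; clarsimp; metis add.assoc)
  qed
  show "A + B = B + A"
  proof (rule fuzzy_number_eqI)
    fix \<alpha> :: real assume "\<alpha> \<in> {0..1}"
    show "level (A + B) \<alpha> = level (B + A) \<alpha>"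
      unfolding level_plus[OF \<open>\<alpha> \<in> {0..1}\<close>]
      by (intro set_eqI iffI; clarsimp; metis add.commute)
  qed
  show "0 + A = A"
    by (rule fuzzy_number_eqI) (simp add: level_plus zero_fuzzy_number_def level_crisp)
qed

text \<open>Fuzzy numbers whose 1-level is a singleton, and the unique element of that level.\<close>

definition singleton_core :: "fuzzy_number set" where
  "singleton_core = {A. is_singleton (level A 1)}"

definition core :: "fuzzy_number \<Rightarrow> real" where
  "core A = the_elem (level A 1)"

definition symmetric :: "fuzzy_number \<Rightarrow> bool" where
  "symmetric A \<longleftrightarrow> (\<forall>y. membership A (- y) = membership A y)"


section \<open>Strongly linearly independent families and the induced operations\<close>

text \<open>
  A finite set \<open>{A\<^sub>1, \<dots>, A\<^sub>n}\<close> of fuzzy numbers is given as a family indexed by a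
  finite type, so that its coefficient vectors are the elements of \<^typ>\<open>real ^ 'n\<close>.
\<close>

definition psi :: "('n::finite \<Rightarrow> fuzzy_number) \<Rightarrow> real ^ 'n \<Rightarrow> fuzzy_number" where
  "psi \<A> q = (\<Sum>i\<in>UNIV. (q $ i) *\<^sub>R \<A> i)"

definition fuzzy_span :: "('n::finite \<Rightarrow> fuzzy_number) \<Rightarrow> fuzzy_number set" where
  "fuzzy_span \<A> = range (psi \<A>)"

definition strongly_independent :: "('n::finite \<Rightarrow> fuzzy_number) \<Rightarrow> bool" where
  "strongly_independent \<A> \<longleftrightarrow> (\<forall>q. symmetric (psi \<A> q) \<longrightarrow> (\<forall>i. q $ i = 0))"

text \<open>
  The operations are transported along \<^const>\<open>psi\<close>; the inverse is meaningful on
  \<^const>\<open>fuzzy_span\<close> because \<^const>\<open>psi\<close> is injective for strongly independent families.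
\<close>

definition psi_plus ::
    "('n::finite \<Rightarrow> fuzzy_number) \<Rightarrow> fuzzy_number \<Rightarrow> fuzzy_number \<Rightarrow> fuzzy_number" where
  "psi_plus \<A> B C = psi \<A> (inv (psi \<A>) B + inv (psi \<A>) C)"

definition psi_minus ::
    "('n::finite \<Rightarrow> fuzzy_number) \<Rightarrow> fuzzy_number \<Rightarrow> fuzzy_number \<Rightarrow> fuzzy_number" where
  "psi_minus \<A> B C = psi \<A> (inv (psi \<A>) B - inv (psi \<A>) C)"

definition psi_scale ::
    "('n::finite \<Rightarrow> fuzzy_number) \<Rightarrow> real \<Rightarrow> fuzzy_number \<Rightarrow> fuzzy_number" where
  "psi_scale \<A> c B = psi \<A> (c *\<^sub>R inv (psi \<A>) B)"

text \<open>
  The index \<open>k\<close> is that of the family member \<open>\<A> k = crisp 1\<close>, so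
  \<open>psi \<A> (axis k r)\<close> is the real number \<open>r\<close> regarded as an element of the span.
\<close>

definition psi_cross ::
    "('n::finite \<Rightarrow> fuzzy_number) \<Rightarrow> 'n \<Rightarrow> fuzzy_number \<Rightarrow> fuzzy_number \<Rightarrow> fuzzy_number" where
  "psi_cross \<A> k B C =
     psi_minus \<A> (psi_plus \<A> (psi_scale \<A> (core C) B) (psi_scale \<A> (core B) C))
       (psi \<A> (axis k (core B * core C)))"

end

theory Submission
  imports Defs
begin

text \<open>
  Every level of a fuzzy number is a compact interval. Its midpoint, unlike its length, is
  compatible with addition and with all real scalars, negative ones included
  (\<open>level_midpoint_scaleR\<close>). Hence the level midpoints of
  \<open>psi \<A> q\<close> are linear in the coefficient vector \<open>q\<close>, although \<open>psi \<A>\<close> itself is not additive.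
  Two consequences carry the proof.

  First, a fuzzy number is symmetric as soon as all its level midpoints vanish. If
  \<open>psi \<A> p = psi \<A> q\<close>, the midpoints of \<open>psi \<A> (p - q)\<close> vanish, and strong independence
  gives \<open>p = q\<close>. So \<open>psi \<A>\<close> is injective, and the transported operations are the
  vector operations on coefficients.

  Second, since levels add as Minkowski sums, the level of \<open>psi \<A> q\<close> at \<open>1\<close> consists of the
  single point \<open>\<Sum>i. q $ i * core (\<A> i)\<close>. So \<open>L q = core (psi \<A> q)\<close> is a linear functional,
  with \<open>L e = 1\<close> at the coefficient vector \<open>e\<close> of the crisp number \<open>1\<close>. In
  coefficients, with \<open>A = psi \<A> a\<close>, \<open>B = psi \<A> b\<close> and \<open>L a = c\<close>, the function becomes
  \<open>x \<mapsto> L x a + c x - c (L x) e + b\<close>. The vector \<open>a - c e\<close> lies in the kernel of \<open>L\<close>, so the linear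
  part multiplies \<open>L x\<close> by \<open>c\<close>. As \<open>c \<noteq> 0\<close>, the image determines first \<open>L x\<close> and then \<open>x\<close>
  (\<open>bij_scale_plus_kernel_shear\<close>).
\<close>

definition level_midpoint :: "real \<Rightarrow> fuzzy_number \<Rightarrow> real" where
  "level_midpoint \<alpha> A = (Inf (level A \<alpha>) + Sup (level A \<alpha>)) / 2"

lemma level_eq_interval:
  assumes "\<alpha> \<in> {0..1}"
  obtains a b where "a \<le> b" "level A \<alpha> = {a..b}"
proof -
  note D = level_familyD[OF level_family_level[of A]]
  obtain a b where "level A \<alpha> = {a..b}"
    using connected_compact_interval_1[of "level A \<alpha>"] D(1,2)[OF assms] convex_connected by blast
  with D(3)[OF assms] that show thesis
    by auto
qed

lemma level_midpoint_interval:
  "level A \<alpha> = {a..b} \<Longrightarrow> a \<le> b \<Longrightarrow> level_midpoint \<alpha> A = (a + b) / 2"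
  by (simp add: level_midpoint_def)

lemma level_midpoint_zero: "\<alpha> \<in> {0..1} \<Longrightarrow> level_midpoint \<alpha> 0 = 0"
  by (simp add: level_midpoint_def zero_fuzzy_number_def level_crisp)

lemma level_midpoint_plus:
  assumes "\<alpha> \<in> {0..1}"
  shows "level_midpoint \<alpha> (A + B) = level_midpoint \<alpha> A + level_midpoint \<alpha> B"
proof -
  obtain a b where A: "a \<le> b" "level A \<alpha> = {a..b}"
    using level_eq_interval[OF assms] .
  obtain c d where B: "c \<le> d" "level B \<alpha> = {c..d}"
    using level_eq_interval[OF assms] .
  obtain e f where AB: "e \<le> f" "level (A + B) \<alpha> = {e..f}"
    using level_eq_interval[OF assms] .
  have sum: "{e..f} = {x + y |x y. x \<in> {a..b} \<and> y \<in> {c..d}}"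
    using level_plus[OF assms, of A B] by (simp add: A B AB)
  have "a + c \<in> {e..f}" "b + d \<in> {e..f}"
    unfolding sum using A(1) B(1) by force+
  moreover have "e \<in> {e..f}" "f \<in> {e..f}"
    using AB(1) by auto
  then have "a + c \<le> e" "f \<le> b + d"
    unfolding sum by auto
  ultimately have "e = a + c" "f = b + d"
    by auto
  then show ?thesis
    using level_midpoint_interval[OF A(2,1)] level_midpoint_interval[OF B(2,1)]
      level_midpoint_interval[OF AB(2,1)]
    by (simp add: add_divide_distrib)
qed

text \<open>
  For negative \<open>q\<close> the endpoints of the interval change places, which leaves their sum
  unaffected. This is why midpoints are compatible with all real scalars and endpoints are not.
\<close>

lemma level_midpoint_scaleR:
  assumes "\<alpha> \<in> {0..1}"
  shows "level_midpoint \<alpha> (q *\<^sub>R A) = q * level_midpoint \<alpha> A"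
proof -
  obtain a b where A: "a \<le> b" "level A \<alpha> = {a..b}"
    using level_eq_interval[OF assms] .
  have "level (q *\<^sub>R A) \<alpha> = (*) q ` {a..b}"
    by (auto simp: level_scaleR[OF assms] A)
  then have img: "level (q *\<^sub>R A) \<alpha> = (if 0 \<le> q then {q * a..q * b} else {q * b..q * a})"
    using A(1) by (auto simp: image_mult_atLeastAtMost_if)
  have "level_midpoint \<alpha> (q *\<^sub>R A) = (q * a + q * b) / 2"
  proof (cases "0 \<le> q")
    case True
    then show ?thesis
      using img A(1) by (simp add: level_midpoint_interval mult_left_mono)
  next
    case False
    then show ?thesis
      using img A(1) by (simp add: level_midpoint_interval mult_left_mono_neg add.commute)
  qed
  then show ?thesis
    by (simp add: level_midpoint_interval[OF A(2,1)] distrib_left)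
qed

lemma level_midpoint_psi:
  assumes "\<alpha> \<in> {0..1}"
  shows "level_midpoint \<alpha> (psi \<A> q) = (\<Sum>i\<in>UNIV. q $ i * level_midpoint \<alpha> (\<A> i))"
proof -
  have "level_midpoint \<alpha> (\<Sum>i\<in>I. q $ i *\<^sub>R \<A> i) = (\<Sum>i\<in>I. q $ i * level_midpoint \<alpha> (\<A> i))"
    if "finite I" for I
    using that
    by induction (simp_all add: level_midpoint_zero[OF assms] level_midpoint_plus[OF assms]
        level_midpoint_scaleR[OF assms])
  then show ?thesis
    by (simp add: psi_def)
qed

text \<open>
  An interval with midpoint \<open>0\<close> is invariant under negation. Applied to the level at
  \<open>membership A x\<close>, which contains \<open>x\<close>, this puts \<open>- x\<close> into the same level.
\<close>

lemma symmetric_if_level_midpoints_zero: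
  assumes mid: "\<And>\<alpha>. \<alpha> \<in> {0<..1} \<Longrightarrow> level_midpoint \<alpha> A = 0"
  shows "symmetric A"
proof -
  have le: "membership A x \<le> membership A (- x)" for x
  proof (cases "membership A x = 0")
    case False
    have "is_fuzzy_number (membership A)"
      using membership[of A] by simp
    then have \<alpha>: "membership A x \<in> {0<..1}"
      using False by (auto simp: is_fuzzy_number_def order_less_le)
    then have "membership A x \<in> {0..1}"
      by simp
    then obtain a b where ab: "a \<le> b" "level A (membership A x) = {a..b}"
      by (rule level_eq_interval)
    have "a + b = 0"
      using mid[OF \<alpha>] level_midpoint_interval[OF ab(2,1)] by simp
    moreover have "x \<in> level A (membership A x)"
      using False by (simp add: fuzzy_level_def)
    ultimately have "- x \<in> level A (membership A x)"
      using ab(2) by auto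
    then show ?thesis
      using False by (simp add: fuzzy_level_def)
  qed (use membership[of A] in \<open>simp add: is_fuzzy_number_def\<close>)
  then show ?thesis
    unfolding symmetric_def by (metis antisym minus_minus)
qed

lemma inj_psi_if_strongly_independent:
  assumes "strongly_independent \<A>"
  shows "inj (psi \<A>)"
proof (rule injI)
  fix p q assume eq: "psi \<A> p = psi \<A> q"
  have "level_midpoint \<alpha> (psi \<A> (p - q)) = 0" if "\<alpha> \<in> {0<..1}" for \<alpha>
  proof -
    have \<alpha>: "\<alpha> \<in> {0..1}"
      using that by auto
    have "level_midpoint \<alpha> (psi \<A> (p - q))
        = level_midpoint \<alpha> (psi \<A> p) - level_midpoint \<alpha> (psi \<A> q)"
      by (simp add: level_midpoint_psi[OF \<alpha>] left_diff_distrib sum_subtractf)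
    then show ?thesis
      by (simp add: eq)
  qed
  then have "symmetric (psi \<A> (p - q))"
    by (rule symmetric_if_level_midpoints_zero)
  then have "(p - q) $ i = 0" for i
    using assms unfolding strongly_independent_def by blast
  then show "p = q"
    by (simp add: vec_eq_iff)
qed

text \<open>
  The levels of a Minkowski sum at \<open>1\<close> are again singletons when those of the summands are, so
  on the span the core really is the element of the level and not a default value.
\<close>

lemma level_psi_one:
  assumes "\<And>i. \<A> i \<in> singleton_core"
  shows "level (psi \<A> q) 1 = {\<Sum>i\<in>UNIV. q $ i * core (\<A> i)}"
proof -
  have core: "level (\<A> i) 1 = {core (\<A> i)}" for i
    using assms[of i] by (auto simp: singleton_core_def core_def is_singleton_the_elem)
  have "level (\<Sum>i\<in>I. q $ i *\<^sub>R \<A> i) 1 = {\<Sum>i\<in>I. q $ i * core (\<A> i)}" if "finite I" for I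
    using that
    by induction (simp_all add: zero_fuzzy_number_def level_crisp level_plus level_scaleR core)
  then show ?thesis
    by (simp add: psi_def)
qed

lemma core_psi:
  assumes "\<And>i. \<A> i \<in> singleton_core"
  shows "core (psi \<A> q) = (\<Sum>i\<in>UNIV. q $ i * core (\<A> i))"
  by (simp add: core_def[of "psi \<A> q"] level_psi_one[OF assms])

lemma linear_core_psi:
  assumes "\<And>i. \<A> i \<in> singleton_core"
  shows "linear (\<lambda>q. core (psi \<A> q))"
  unfolding core_psi[OF assms]
  by (rule linearI) (simp_all add: distrib_right sum.distrib sum_distrib_left mult.assoc)

text \<open>
  Since \<open>L v = 0\<close>, the functional \<open>L\<close> takes the value \<open>c * L x + L b\<close> at the image of \<open>x\<close>. This
  recovers \<open>L x\<close>, and with it the whole of \<open>x\<close>.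
\<close>

lemma bij_scale_plus_kernel_shear:
  fixes L :: "'a::real_vector \<Rightarrow> real"
  assumes "linear L" "L v = 0" "c \<noteq> 0"
  shows "bij (\<lambda>x. c *\<^sub>R x + L x *\<^sub>R v + b)"
proof (rule o_bij)
  note lin = linear_add[OF assms(1)] linear_diff[OF assms(1)] linear_scale[OF assms(1)]
  let ?F = "\<lambda>x. c *\<^sub>R x + L x *\<^sub>R v + b"
  let ?G = "\<lambda>z. (1 / c) *\<^sub>R (z - b - (L (z - b) / c) *\<^sub>R v)"
  show "?G \<circ> ?F = id" "?F \<circ> ?G = id"
    using assms(2,3) by (auto simp: fun_eq_iff lin)
qed

lemma psi_cross_psi:
  assumes "inj (psi \<A>)"
  shows "psi_cross \<A> k (psi \<A> p) (psi \<A> q) =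
    psi \<A> (core (psi \<A> q) *\<^sub>R p + core (psi \<A> p) *\<^sub>R q
      - axis k (core (psi \<A> p) * core (psi \<A> q)))"
  by (simp add: psi_cross_def psi_minus_def psi_plus_def psi_scale_def inv_f_f[OF assms])

theorem proposition2:
  fixes \<A> :: "'n::finite \<Rightarrow> fuzzy_number" and k :: 'n and A B :: fuzzy_number
  assumes "\<A> k = crisp 1"
    and "\<And>i. \<A> i \<in> singleton_core"
    and "\<And>i. i \<noteq> k \<Longrightarrow> \<A> i \<notin> range crisp"
    and "strongly_independent \<A>"
    and "A \<in> fuzzy_span \<A>" and "B \<in> fuzzy_span \<A>"
    and "level A 1 \<noteq> {0}"
  shows "bij_betw (\<lambda>X. psi_plus \<A> (psi_cross \<A> k A X) B) (fuzzy_span \<A>) (fuzzy_span \<A>)"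
proof -
  obtain a b where AB: "A = psi \<A> a" "B = psi \<A> b"
    using assms(5,6) by (auto simp: fuzzy_span_def)
  define L where "L q = core (psi \<A> q)" for q
  define e :: "real ^ 'n" where "e = axis k 1"
  \<comment> \<open>The coefficient form of the function, with the multiples of \<open>L x\<close> collected.\<close>
  define G where "G x = L a *\<^sub>R x + L x *\<^sub>R (a - L a *\<^sub>R e) + b" for x
  have inj: "inj (psi \<A>)"
    using assms(4) by (rule inj_psi_if_strongly_independent)
  have lin: "linear L"
    unfolding L_def using assms(2) by (rule linear_core_psi)
  have "core (\<A> k) = 1"
    by (simp add: assms(1) core_def level_crisp)
  then have "L e = 1"
    by (simp add: L_def e_def core_psi[OF assms(2)] axis_def if_distrib[of "\<lambda>x. x * _"] cong: if_cong)
  then have ker: "L (a - L a *\<^sub>R e) = 0"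
    by (simp add: linear_diff[OF lin] linear_scale[OF lin])
  have "L a \<noteq> 0"
    using assms(7) by (simp add: AB L_def core_psi[OF assms(2)] level_psi_one[OF assms(2)])
  with lin ker have bijG: "bij G"
    unfolding G_def by (rule bij_scale_plus_kernel_shear)
  have psi: "bij_betw (psi \<A>) UNIV (fuzzy_span \<A>)"
    using inj by (simp add: bij_betw_def fuzzy_span_def)
  have axis: "axis k r = r *\<^sub>R e" for r
    by (simp add: e_def axis_def vec_eq_iff)
  have conj: "psi_plus \<A> (psi_cross \<A> k A (psi \<A> x)) B = psi \<A> (G x)" for x
    by (simp add: AB psi_cross_psi[OF inj] psi_plus_def inv_f_f[OF inj] G_def L_def axis
        algebra_simps)
  have "bij_betw (psi \<A> \<circ> G \<circ> inv (psi \<A>)) (fuzzy_span \<A>) (fuzzy_span \<A>)"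
    by (intro bij_betw_trans[of _ _ UNIV] bij_betw_trans[OF bij_betw_inv_into[OF psi]] bijG psi)
  moreover have "(psi \<A> \<circ> G \<circ> inv (psi \<A>)) X = psi_plus \<A> (psi_cross \<A> k A X) B"
    if "X \<in> fuzzy_span \<A>" for X
    using that by (auto simp: fuzzy_span_def inv_f_f[OF inj] conj)
  ultimately show ?thesis
    by (simp cong: bij_betw_cong)
qed

end
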